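(* Let $f:\mathbb{R}^{d_0}\to\mathbb{R}^{d_L}$ be an MLP $x^0=x$, $x^l=h(W_lx^{l-1}+b_l)$ for $l=1,\dots,L$, $f(x)=x^L$, where $h$ is the LeakyReLU with slope $\alpha\in(0,1)$ applied componentwise, each $W_l\in\mathbb{R}^{d_l\times d_{l-1}}$ has full rank (rank $\min(d_l,d_{l-1})$), and the dimensions are monotone: either $d_0\le d_1\le\dots\le d_L$ or $d_0\ge d_1\ge\dots\ge d_L$. Then there is a Lebesgue-null set $\mathcal{N}\subset\mathbb{R}^{d_0}$ such that $f$ is differentiable on $\mathbb{R}^{d_0}\setminus\mathcal{N}$ with Jacobian of full rank $\min(d_0,d_L)$ there. If in addition $d_L\le d_0$, then $f$ is surjective onto $\mathbb{R}^{d_L}$.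
   Context: The LeakyReLU with slope $\alpha$ is $h(t)=\max(0,t)+\alpha\min(0,t)$. *)

theory Defs
  imports "HOL-Analysis.Analysis" "Jordan_Normal_Form.DL_Rank"
begin

text \<open>LeakyReLU with slope alpha.\<close>
definition leaky_relu :: "real \<Rightarrow> real \<Rightarrow> real" where
  "leaky_relu \<alpha> t = max 0 t + \<alpha> * min 0 t"

text \<open>Hidden states of the MLP: x^0 = x, x^l = h(W_l x^(l-1) + b_l).\<close>
fun mlp_layer :: "real \<Rightarrow> (nat \<Rightarrow> real mat) \<Rightarrow> (nat \<Rightarrow> real Matrix.vec) \<Rightarrow> nat \<Rightarrow> real Matrix.vec \<Rightarrow> real Matrix.vec" where
  "mlp_layer \<alpha> W b 0 x = x"
| "mlp_layer \<alpha> W b (Suc l) x =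
     map_vec (leaky_relu \<alpha>) (W (Suc l) *\<^sub>v mlp_layer \<alpha> W b l x + b (Suc l))"

text \<open>Identification of real^'n with R^{CARD('n)} via the canonical enumeration of the finite type.\<close>
definition vec_of_cart :: "real^'n::finite \<Rightarrow> real Matrix.vec" where
  "vec_of_cart x = Matrix.vec CARD('n) (\<lambda>j. x $ from_nat_into (UNIV :: 'n set) j)"

definition cart_of_vec :: "real Matrix.vec \<Rightarrow> real^'m::finite" where
  "cart_of_vec v = (\<chi> i. vec_index v (to_nat_on (UNIV :: 'm set) i))"

text \<open>The network function f : R^{d_0} -> R^{d_L}, f(x) = x^L.\<close>
definition mlp :: "real \<Rightarrow> (nat \<Rightarrow> real mat) \<Rightarrow> (nat \<Rightarrow> real Matrix.vec) \<Rightarrow> nat \<Rightarrow> real^'n::finite \<Rightarrow> real^'m::finite" where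
  "mlp \<alpha> W b L x = cart_of_vec (mlp_layer \<alpha> W b L (vec_of_cart x))"

end

theory Submission
  imports Defs
begin

(* Off a finite union of hyperplanes the network is locally affine: near such a point every
   pre-activation coordinate that is not constant keeps its sign, so each LeakyReLU layer acts as
   multiplication by a diagonal matrix with entries in {1, alpha}. The local Jacobian is then a
   product D_L W_L ... D_1 W_1 with invertible diagonal D_l, and monotone widths make the W_l all
   injective or all surjective, hence so is the product: its rank is min d_0 d_L. Surjectivity for
   d_L <= d_0 follows layer by layer, since then every W_l is onto and LeakyReLU is a bijection. *)

lemma to_nat_on_UNIV_less_card: "to_nat_on (UNIV :: 'n::finite set) k < CARD('n)"
  using to_nat_on_finite[of "UNIV :: 'n set"] by (auto simp: bij_betw_def)

lemma to_nat_on_from_nat_into_less_card: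
  "j < CARD('n::finite) \<Longrightarrow> to_nat_on (UNIV :: 'n set) (from_nat_into UNIV j) = j"
  using to_nat_on_finite[of "UNIV :: 'n set"]
  by (intro to_nat_on_from_nat_into) (auto simp: bij_betw_def)

lemma vec_of_cart_carrier [simp]: "vec_of_cart (x :: real^'n::finite) \<in> carrier_vec CARD('n)"
  by (simp add: vec_of_cart_def)

lemma cart_of_vec_of_cart [simp]: "cart_of_vec (vec_of_cart x) = (x :: real^'n::finite)"
  by (simp add: cart_of_vec_def vec_of_cart_def to_nat_on_UNIV_less_card
      from_nat_into_to_nat_on Finite_Cartesian_Product.vec_eq_iff)

lemma vec_of_cart_of_vec:
  "v \<in> carrier_vec CARD('n::finite) \<Longrightarrow> vec_of_cart (cart_of_vec v :: real^'n) = v"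
  by (auto simp: cart_of_vec_def vec_of_cart_def to_nat_on_from_nat_into_less_card)

lemma vec_of_cart_add: "vec_of_cart (x + y :: real^'n::finite) = vec_of_cart x + vec_of_cart y"
  by (auto simp: vec_of_cart_def)

lemma vec_of_cart_scaleR: "vec_of_cart (r *\<^sub>R x :: real^'n::finite) = r \<cdot>\<^sub>v vec_of_cart x"
  by (auto simp: vec_of_cart_def)

lemma cart_of_vec_add:
  "u \<in> carrier_vec CARD('n::finite) \<Longrightarrow> v \<in> carrier_vec CARD('n) \<Longrightarrow>
    (cart_of_vec (u + v) :: real^'n) = cart_of_vec u + cart_of_vec v"
  by (auto simp: cart_of_vec_def Finite_Cartesian_Product.vec_eq_iff to_nat_on_UNIV_less_card)

lemma cart_of_vec_smult:
  "u \<in> carrier_vec CARD('n::finite) \<Longrightarrow> (cart_of_vec (r \<cdot>\<^sub>v u) :: real^'n) = r *\<^sub>R cart_of_vec u"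
  by (auto simp: cart_of_vec_def Finite_Cartesian_Product.vec_eq_iff to_nat_on_UNIV_less_card)

lemma cart_of_vec_eq_0_iff:
  assumes "v \<in> carrier_vec CARD('n::finite)"
  shows "(cart_of_vec v = (0 :: real^'n)) \<longleftrightarrow> v = 0\<^sub>v CARD('n)"
proof
  assume "cart_of_vec v = (0 :: real^'n)"
  then have "v = vec_of_cart (0 :: real^'n)"
    using vec_of_cart_of_vec[OF assms] by metis
  then show "v = 0\<^sub>v CARD('n)"
    by (auto simp: vec_of_cart_def)
qed (simp add: cart_of_vec_def Finite_Cartesian_Product.vec_eq_iff to_nat_on_UNIV_less_card)

lemma scalar_prod_vec_of_cart:
  assumes "r \<in> carrier_vec CARD('n::finite)"
  shows "r \<bullet> vec_of_cart (y :: real^'n) = inner (cart_of_vec r :: real^'n) y"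
proof -
  have bij: "bij_betw (to_nat_on (UNIV :: 'n set)) UNIV {..<CARD('n)}"
    by (simp add: to_nat_on_finite)
  have "r \<bullet> vec_of_cart y = (\<Sum>j<CARD('n). r $ j * y $ from_nat_into UNIV j)"
    using assms by (simp add: scalar_prod_def vec_of_cart_def atLeast0LessThan)
  also have "\<dots> = (\<Sum>k\<in>UNIV. r $ to_nat_on UNIV k * y $ k)"
    using sum.reindex_bij_betw[OF bij, of "\<lambda>j. vec_index r j * vec_nth y (from_nat_into UNIV j)"]
    by simp
  also have "\<dots> = inner (cart_of_vec r :: real^'n) y"
    by (simp add: inner_vec_def cart_of_vec_def)
  finally show ?thesis .
qed

definition cart_map :: "real mat \<Rightarrow> real^'n::finite \<Rightarrow> real^'m::finite" where
  "cart_map M y = cart_of_vec (M *\<^sub>v vec_of_cart y)"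

lemma linear_cart_map:
  assumes M: "M \<in> carrier_mat CARD('m::finite) CARD('n::finite)"
  shows "linear (cart_map M :: real^'n \<Rightarrow> real^'m)"
proof
  fix y z :: "real^'n" and r :: real
  show "cart_map M (y + z) = (cart_map M y + cart_map M z :: real^'m)"
    using M by (simp add: cart_map_def vec_of_cart_add mult_add_distrib_mat_vec cart_of_vec_add)
  show "cart_map M (r *\<^sub>R y) = (r *\<^sub>R cart_map M y :: real^'m)"
    using M by (simp add: cart_map_def vec_of_cart_scaleR mult_mat_vec cart_of_vec_smult)
qed

lemma rank_matrix_cart_map:
  assumes M: "M \<in> carrier_mat CARD('m::finite) CARD('n::finite)"
  shows "inj_on ((*\<^sub>v) M) (carrier_vec CARD('n)) \<Longrightarrow>
      rank (matrix (cart_map M :: real^'n \<Rightarrow> real^'m)) = CARD('n)"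
    and "carrier_vec CARD('m) \<subseteq> (*\<^sub>v) M ` carrier_vec CARD('n) \<Longrightarrow>
      rank (matrix (cart_map M :: real^'n \<Rightarrow> real^'m)) = CARD('m)"
proof -
  let ?G = "cart_map M :: real^'n \<Rightarrow> real^'m"
  have G: "(*v) (matrix ?G) = ?G"
    using linear_cart_map[OF M] by (simp add: matrix_works fun_eq_iff)
  have Mv: "M *\<^sub>v vec_of_cart y \<in> carrier_vec CARD('m)" for y :: "real^'n"
    using M by simp
  show "rank (matrix ?G) = CARD('n)" if inj: "inj_on ((*\<^sub>v) M) (carrier_vec CARD('n))"
  proof -
    have "inj ?G"
    proof (rule injI)
      fix y z :: "real^'n" assume "?G y = ?G z"
      then have "vec_of_cart (?G y) = vec_of_cart (?G z)" by simp
      then have "M *\<^sub>v vec_of_cart y = M *\<^sub>v vec_of_cart z"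
        by (simp add: cart_map_def vec_of_cart_of_vec[OF Mv])
      then show "y = z"
        using inj_onD[OF inj] by (metis cart_of_vec_of_cart vec_of_cart_carrier)
    qed
    then show ?thesis by (simp add: full_rank_injective G)
  qed
  show "rank (matrix ?G) = CARD('m)" if surj: "carrier_vec CARD('m) \<subseteq> (*\<^sub>v) M ` carrier_vec CARD('n)"
  proof -
    have "z \<in> range ?G" for z
    proof -
      have "vec_of_cart z \<in> (*\<^sub>v) M ` carrier_vec CARD('n)"
        using surj vec_of_cart_carrier by (rule subsetD)
      then obtain v where Mv: "vec_of_cart z = M *\<^sub>v v" and v: "v \<in> carrier_vec CARD('n)"
        by (rule imageE)
      have "?G (cart_of_vec v) = cart_of_vec (M *\<^sub>v v)"
        using v by (simp add: cart_map_def vec_of_cart_of_vec)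
      then show ?thesis
        unfolding Mv[symmetric] by (metis cart_of_vec_of_cart rangeI)
    qed
    then have "surj ?G" by auto
    then show ?thesis by (simp only: full_rank_surjective G)
  qed
qed

lemma has_derivative_cart_map_if_locally_affine:
  assumes M: "M \<in> carrier_mat CARD('m::finite) CARD('n::finite)" and c: "c \<in> carrier_vec CARD('m)"
    and f: "eventually (\<lambda>y. f y = cart_of_vec (M *\<^sub>v vec_of_cart y + c)) (nhds x)"
  shows "(f has_derivative (cart_map M :: real^'n \<Rightarrow> real^'m)) (at x)"
proof -
  have "eventually (\<lambda>y. cart_map M y + cart_of_vec c = f y) (nhds x)"
    using f by eventually_elim (use M c in \<open>simp add: cart_map_def cart_of_vec_add\<close>)
  moreover have "((\<lambda>y. cart_map M y + cart_of_vec c) has_derivative (cart_map M :: real^'n \<Rightarrow> real^'m)) (at x)"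
    by (intro has_derivative_add_const linear_imp_has_derivative linear_cart_map[OF M])
  ultimately show ?thesis
    unfolding eventually_nhds_conv_at by (auto intro: has_derivative_transform_eventually)
qed

lemma (in vec_space) rank_eq_card_indpt_cols:
  assumes A: "A \<in> carrier_mat n nc"
  obtains S where "S \<subseteq> set (cols A)" "lin_indpt S" "finite S" "rank A = card S"
proof -
  have "lin_indpt {}"
    by (metis empty_subsetI fin_dim finite_basis_exists subset_li_is_li vec_vs vectorspace.basis_def)
  then obtain S where S: "finite S" "maximal S (\<lambda>T. T \<subseteq> set (cols A) \<and> lin_indpt T)"
    using maximal_exists_superset[of "set (cols A)" "\<lambda>T. T \<subseteq> set (cols A) \<and> lin_indpt T" "{}"]
    by auto
  with rank_card_indpt[OF A] show thesis
    by (intro that[of S]) (auto simp: maximal_def)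
qed

lemma inj_on_mult_mat_vec_if_rank_eq_dim_col:
  fixes A :: "real mat"
  assumes A: "A \<in> carrier_mat nr nc" and rank: "vec_space.rank nr A = nc"
  shows "inj_on ((*\<^sub>v) A) (carrier_vec nc)"
proof -
  interpret vec_space "TYPE(real)" nr .
  have distinct: "distinct (cols A)"
  proof (rule ccontr)
    assume "\<not> distinct (cols A)"
    then have "card (set (cols A)) < nc"
      using A by (metis card_distinct card_length cols_length carrier_matD(2) le_neq_implies_less)
    moreover obtain S where "S \<subseteq> set (cols A)" "rank A = card S"
      using rank_eq_card_indpt_cols[OF A] .
    ultimately show False
      using rank card_mono[of "set (cols A)" S] by simp
  qed
  show ?thesis
  proof (rule inj_onI)
    fix v w assume v: "v \<in> carrier_vec nc" and w: "w \<in> carrier_vec nc" and "A *\<^sub>v v = A *\<^sub>v w"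
    then have "A *\<^sub>v (v - w) = 0\<^sub>v nr"
      using A by (simp add: mult_minus_distrib_mat_vec)
    moreover have "lin_indpt (set (cols A))"
      by (rule full_rank_lin_indpt[OF A rank distinct])
    ultimately have "v - w = 0\<^sub>v nc"
      using lin_depI[OF A _ _ _ distinct, of "v - w"] v w by auto
    then show "v = w"
      using v w by (metis comm_add_vec left_zero_vec minus_add_uminus_vec uminus_l_inv_vec
          assoc_add_vec uminus_carrier_vec)
  qed
qed

lemma carrier_vec_subset_image_mult_mat_vec_if_rank_eq_dim_row:
  fixes A :: "real mat"
  assumes A: "A \<in> carrier_mat nr nc" and rank: "vec_space.rank nr A = nr"
  shows "carrier_vec nr \<subseteq> (*\<^sub>v) A ` carrier_vec nc"
proof -
  interpret vec_space "TYPE(real)" nr .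
  obtain S where S: "S \<subseteq> set (cols A)" "lin_indpt S" "finite S" "card S = nr"
    using rank_eq_card_indpt_cols[OF A] rank by metis
  moreover have "S \<subseteq> carrier_vec nr"
    using S(1) cols_dim[of A] A by auto
  ultimately have "basis S"
    by (intro dim_li_is_basis) (auto simp: dim_is_n)
  then have "carrier_vec nr \<subseteq> span (set (cols A))"
    using span_is_monotone[OF S(1)] by (auto simp: basis_def)
  then show ?thesis
    using col_space_eq[OF A] A by (auto simp: col_space_def)
qed

lemma inj_on_mult_mat_vec_mult:
  assumes "A \<in> carrier_mat n m" "B \<in> carrier_mat m k"
    and "inj_on ((*\<^sub>v) A) (carrier_vec m)" "inj_on ((*\<^sub>v) B) (carrier_vec k)"
  shows "inj_on ((*\<^sub>v) (A * B)) (carrier_vec k)"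
  using assms by (auto simp: inj_on_def assoc_mult_mat_vec)

lemma image_mult_mat_vec_mult:
  fixes A B :: "'a::semiring_0 mat"
  assumes "A \<in> carrier_mat n m" "B \<in> carrier_mat m k"
    and "carrier_vec n \<subseteq> (*\<^sub>v) A ` carrier_vec m" "carrier_vec m \<subseteq> (*\<^sub>v) B ` carrier_vec k"
  shows "carrier_vec n \<subseteq> (*\<^sub>v) (A * B) ` carrier_vec k"
proof
  fix y :: "'a vec" assume "y \<in> carrier_vec n"
  then have "y \<in> (*\<^sub>v) A ` carrier_vec m"
    using assms(3) by (rule subsetD[rotated])
  then obtain u where y: "y = A *\<^sub>v u" and u: "u \<in> carrier_vec m"
    by (rule imageE)
  from u have "u \<in> (*\<^sub>v) B ` carrier_vec k"
    using assms(4) by (rule subsetD[rotated])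
  then obtain v where "u = B *\<^sub>v v" and v: "v \<in> carrier_vec k"
    by (rule imageE)
  with y have "y = (A * B) *\<^sub>v v"
    using assms(1,2) by (simp add: assoc_mult_mat_vec)
  then show "y \<in> (*\<^sub>v) (A * B) ` carrier_vec k"
    using v by (rule image_eqI)
qed

lemma mat_diag_mult_vec:
  assumes v: "v \<in> carrier_vec n"
  shows "mat_diag n s *\<^sub>v v = vec n (\<lambda>i. s i * v $ i)"
proof (rule eq_vecI)
  fix i assume "i < dim_vec (vec n (\<lambda>i. s i * v $ i))"
  then have i: "i < n" by simp
  have "(mat_diag n s *\<^sub>v v) $ i = (\<Sum>j\<in>{0..<n}. (if i = j then s j else 0) * v $ j)"
    using v i by (simp add: mat_diag_def scalar_prod_def)
  also have "\<dots> = (\<Sum>j\<in>{0..<n}. if i = j then s i * v $ i else 0)"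
    by (rule sum.cong) auto
  finally show "(mat_diag n s *\<^sub>v v) $ i = vec n (\<lambda>i. s i * v $ i) $ i"
    using i by simp
qed (simp add: mat_diag_def)

lemma inj_on_mat_diag:
  fixes s :: "nat \<Rightarrow> 'a::field"
  assumes "\<forall>i<n. s i \<noteq> 0"
  shows "inj_on ((*\<^sub>v) (mat_diag n s)) (carrier_vec n)"
proof (rule inj_onI)
  fix v w assume v: "v \<in> carrier_vec n" and w: "w \<in> carrier_vec n"
    and eq: "mat_diag n s *\<^sub>v v = mat_diag n s *\<^sub>v w"
  have "v $ i = w $ i" if i: "i < n" for i
  proof -
    have "s i * v $ i = s i * w $ i"
      using arg_cong[OF eq, of "\<lambda>x. x $ i"] i v w by (simp add: mat_diag_mult_vec)
    then show ?thesis
      using assms i by simp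
  qed
  then show "v = w"
    using v w by (intro eq_vecI) simp_all
qed

lemma carrier_vec_subset_image_mat_diag:
  fixes s :: "nat \<Rightarrow> 'a::field"
  assumes "\<forall>i<n. s i \<noteq> 0"
  shows "carrier_vec n \<subseteq> (*\<^sub>v) (mat_diag n s) ` carrier_vec n"
proof
  fix y :: "'a vec" assume y: "y \<in> carrier_vec n"
  define v where "v = vec n (\<lambda>i. y $ i / s i)"
  have "mat_diag n s *\<^sub>v v = vec n (\<lambda>i. s i * v $ i)"
    by (simp add: v_def mat_diag_mult_vec)
  also have "\<dots> = y"
    using y assms by (intro eq_vecI) (simp_all add: v_def)
  finally show "y \<in> (*\<^sub>v) (mat_diag n s) ` carrier_vec n"
    by (metis imageI vec_carrier v_def)
qed

lemma mult_mat_vec_add_mult: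
  assumes D: "D \<in> carrier_mat n m" and A: "A \<in> carrier_mat m k"
    and u: "u \<in> carrier_vec k" and e: "e \<in> carrier_vec m"
  shows "D *\<^sub>v (A *\<^sub>v u + e) = (D * A) *\<^sub>v u + D *\<^sub>v e"
proof -
  have "D *\<^sub>v (A *\<^sub>v u + e) = D *\<^sub>v (A *\<^sub>v u) + D *\<^sub>v e"
    by (rule mult_add_distrib_mat_vec[OF D _ e]) (use A u in simp)
  then show ?thesis
    by (simp only: assoc_mult_mat_vec[OF D A u])
qed

definition leaky_slope :: "real \<Rightarrow> real \<Rightarrow> real" where
  "leaky_slope \<alpha> t = (if 0 \<le> t then 1 else \<alpha>)"

lemma leaky_relu_eq_slope_mult: "leaky_relu \<alpha> t = leaky_slope \<alpha> t * t"
  by (simp add: leaky_relu_def leaky_slope_def)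

lemma leaky_relu_divide_slope: "0 < \<alpha> \<Longrightarrow> leaky_relu \<alpha> (t / leaky_slope \<alpha> t) = t"
  by (auto simp: leaky_relu_def leaky_slope_def min_def max_def zero_le_divide_iff)

lemma eventually_leaky_relu_eq_slope_mult:
  fixes z :: "'a::t2_space \<Rightarrow> real"
  assumes "isCont z x" "z x \<noteq> 0"
  shows "eventually (\<lambda>y. leaky_relu \<alpha> (z y) = leaky_slope \<alpha> (z x) * z y) (nhds x)"
proof -
  have lim: "(z \<longlongrightarrow> z x) (at x)"
    using assms(1) by (simp add: isCont_def)
  have "eventually (\<lambda>y. leaky_slope \<alpha> (z y) = leaky_slope \<alpha> (z x)) (at x)"
  proof (cases "0 < z x")
    case True
    from order_tendstoD(1)[OF lim True] show ?thesis
      by eventually_elim (use True in \<open>simp add: leaky_slope_def\<close>)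
  next
    case False
    with assms(2) have "z x < 0" by simp
    from order_tendstoD(2)[OF lim this] show ?thesis
      by eventually_elim (use \<open>z x < 0\<close> in \<open>simp add: leaky_slope_def\<close>)
  qed
  then show ?thesis
    by (auto simp: eventually_nhds_conv_at leaky_relu_eq_slope_mult elim: eventually_mono)
qed

(* Off this set every coordinate of y \<mapsto> A y + e is either constant or locally of fixed sign. *)
definition kink_set :: "real mat \<Rightarrow> real vec \<Rightarrow> (real^'n::finite) set" where
  "kink_set A e =
     {y. \<exists>i<dim_row A. row A i \<noteq> 0\<^sub>v (dim_col A) \<and> (A *\<^sub>v vec_of_cart y + e) $ i = 0}"

lemma affine_component_eq_inner:
  assumes A: "A \<in> carrier_mat n CARD('n::finite)" and e: "e \<in> carrier_vec n" and i: "i < n"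
  shows "(A *\<^sub>v vec_of_cart (y :: real^'n) + e) $ i = inner (cart_of_vec (row A i) :: real^'n) y + e $ i"
  using A e i by (simp add: scalar_prod_vec_of_cart)

lemma kink_set_null:
  assumes A: "A \<in> carrier_mat n CARD('n::finite)" and e: "e \<in> carrier_vec n"
  shows "kink_set A e \<in> null_sets (lborel :: (real^'n) measure)"
proof -
  define H where "H i = {y :: real^'n. inner (cart_of_vec (row A i) :: real^'n) y = - e $ i}" for i
  have "(A *\<^sub>v vec_of_cart y + e) $ i = 0 \<longleftrightarrow> y \<in> H i" if "i < n" for i y
    using affine_component_eq_inner[OF A e that] by (auto simp: H_def eq_neg_iff_add_eq_0)
  then have "kink_set A e = (\<Union>i\<in>{i. i < n \<and> row A i \<noteq> 0\<^sub>v CARD('n)}. H i)"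
    using A by (auto simp: kink_set_def)
  moreover have "H i \<in> null_sets lborel" if "i < n" "row A i \<noteq> 0\<^sub>v CARD('n)" for i
  proof -
    have "cart_of_vec (row A i) \<noteq> (0 :: real^'n)"
      using that A by (simp add: cart_of_vec_eq_0_iff)
    then have "H i \<in> null_sets lebesgue"
      unfolding H_def by (simp add: negligible_hyperplane negligible_iff_null_sets[symmetric])
    moreover have "H i \<in> sets lborel"
      unfolding H_def by (simp add: borel_closed closed_hyperplane)
    ultimately show ?thesis
      using null_sets_completion_iff by blast
  qed
  ultimately show ?thesis
    by (auto intro!: null_sets_UN')
qed

lemma eventually_map_leaky_relu_eq_mat_diag:
  assumes A: "A \<in> carrier_mat n CARD('n::finite)" and e: "e \<in> carrier_vec n"
    and x: "(x :: real^'n) \<notin> kink_set A e"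
  shows "\<exists>s\<in>{..<n} \<rightarrow>\<^sub>E {1, \<alpha>}. eventually (\<lambda>y. map_vec (leaky_relu \<alpha>) (A *\<^sub>v vec_of_cart y + e)
            = mat_diag n s *\<^sub>v (A *\<^sub>v vec_of_cart y + e)) (nhds x)"
proof
  define z where "z i y = (A *\<^sub>v vec_of_cart y + e) $ i" for i and y :: "real^'n"
  define s where "s = restrict (\<lambda>i. leaky_slope \<alpha> (z i x)) {..<n}"
  show "s \<in> {..<n} \<rightarrow>\<^sub>E {1, \<alpha>}"
    by (auto simp: s_def leaky_slope_def)
  have "eventually (\<lambda>y. leaky_relu \<alpha> (z i y) = s i * z i y) (nhds x)" if i: "i < n" for i
  proof (cases "row A i = 0\<^sub>v CARD('n)")
    case True
    then have "z i y = e $ i" for y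
      using A e i by (simp add: z_def)
    then show ?thesis
      using i by (simp add: s_def leaky_relu_eq_slope_mult)
  next
    case False
    have "z i = (\<lambda>y. inner (cart_of_vec (row A i) :: real^'n) y + vec_index e i)"
      using affine_component_eq_inner[OF A e i] by (simp add: fun_eq_iff z_def)
    then have "isCont (z i) x"
      by (auto intro!: continuous_intros)
    moreover have "z i x \<noteq> 0"
      using False x A i by (auto simp: kink_set_def z_def)
    moreover have "s i = leaky_slope \<alpha> (z i x)"
      using i by (simp add: s_def)
    ultimately show ?thesis
      using eventually_leaky_relu_eq_slope_mult by metis
  qed
  then have "eventually (\<lambda>y. \<forall>i\<in>{..<n}. leaky_relu \<alpha> (z i y) = s i * z i y) (nhds x)"
    by (intro eventually_ball_finite) auto
  then show "eventually (\<lambda>y. map_vec (leaky_relu \<alpha>) (A *\<^sub>v vec_of_cart y + e)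
      = mat_diag n s *\<^sub>v (A *\<^sub>v vec_of_cart y + e)) (nhds x)"
    by eventually_elim (rule eq_vecI, use A e in \<open>auto simp: z_def mat_diag_mult_vec\<close>)
qed

lemma lift_Suc_mono_le_bounded:
  fixes f :: "nat \<Rightarrow> 'a::preorder"
  assumes mono: "\<forall>k<L. f k \<le> f (Suc k)" and "i \<le> j" "j \<le> L"
  shows "f i \<le> f j"
  using assms(2,3)
proof (induction j rule: dec_induct)
  case (step n)
  then have "f i \<le> f n" "f n \<le> f (Suc n)"
    using mono by simp_all
  then show ?case
    by (rule order_trans)
qed simp

lemma lift_Suc_antimono_le_bounded:
  fixes f :: "nat \<Rightarrow> 'a::preorder"
  assumes antimono: "\<forall>k<L. f (Suc k) \<le> f k" and "i \<le> j" "j \<le> L"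
  shows "f j \<le> f i"
  using assms(2,3)
proof (induction j rule: dec_induct)
  case (step n)
  then have "f (Suc n) \<le> f n" "f n \<le> f i"
    using antimono by simp_all
  then show ?case
    by (rule order_trans)
qed simp

locale leaky_mlp =
  fixes \<alpha> :: real and W :: "nat \<Rightarrow> real mat" and b :: "nat \<Rightarrow> real vec"
    and d :: "nat \<Rightarrow> nat" and L :: nat
  assumes alpha_pos: "0 < \<alpha>"
    and W_dim: "\<forall>l\<in>{1..L}. W l \<in> carrier_mat (d l) (d (l - 1))"
    and b_dim: "\<forall>l\<in>{1..L}. b l \<in> carrier_vec (d l)"
    and W_rank: "\<forall>l\<in>{1..L}. vec_space.rank (d l) (W l) = min (d l) (d (l - 1))"
begin

lemma W_carrier: "l < L \<Longrightarrow> W (Suc l) \<in> carrier_mat (d (Suc l)) (d l)"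
  using W_dim by force

lemma b_carrier: "l < L \<Longrightarrow> b (Suc l) \<in> carrier_vec (d (Suc l))"
  using b_dim by force

lemma rank_W: "l < L \<Longrightarrow> vec_space.rank (d (Suc l)) (W (Suc l)) = min (d (Suc l)) (d l)"
  using W_rank by force

lemma W_inj_on: "l < L \<Longrightarrow> d l \<le> d (Suc l) \<Longrightarrow> inj_on ((*\<^sub>v) (W (Suc l))) (carrier_vec (d l))"
  using inj_on_mult_mat_vec_if_rank_eq_dim_col[OF W_carrier] rank_W by (simp add: min_absorb2)

lemma W_onto:
  "l < L \<Longrightarrow> d (Suc l) \<le> d l \<Longrightarrow> carrier_vec (d (Suc l)) \<subseteq> (*\<^sub>v) (W (Suc l)) ` carrier_vec (d l)"
  using carrier_vec_subset_image_mult_mat_vec_if_rank_eq_dim_row[OF W_carrier] rank_W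
  by (simp add: min_absorb1)

lemma carrier_vec_subset_image_mlp_layer:
  assumes dec: "\<forall>k<L. d (Suc k) \<le> d k" and "l \<le> L"
  shows "carrier_vec (d l) \<subseteq> mlp_layer \<alpha> W b l ` carrier_vec (d 0)"
  using \<open>l \<le> L\<close>
proof (induction l)
  case (Suc l)
  then have l: "l < L" by simp
  have W_onto_l: "carrier_vec (d (Suc l)) \<subseteq> (*\<^sub>v) (W (Suc l)) ` carrier_vec (d l)"
    using W_onto[OF l] dec l by simp
  show ?case
  proof
    fix y :: "real vec" assume y: "y \<in> carrier_vec (d (Suc l))"
    define z where "z = vec (d (Suc l)) (\<lambda>i. y $ i / leaky_slope \<alpha> (y $ i))"
    have z: "map_vec (leaky_relu \<alpha>) z = y"
      using y leaky_relu_divide_slope[OF alpha_pos] by (auto simp: z_def)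
    have "z - b (Suc l) \<in> carrier_vec (d (Suc l))"
      using b_carrier[OF l] by (simp add: z_def)
    then have "z - b (Suc l) \<in> (*\<^sub>v) (W (Suc l)) ` carrier_vec (d l)"
      using W_onto_l by (rule subsetD[rotated])
    then obtain u where Wu: "z - b (Suc l) = W (Suc l) *\<^sub>v u" and u: "u \<in> carrier_vec (d l)"
      by (rule imageE)
    from u have "u \<in> mlp_layer \<alpha> W b l ` carrier_vec (d 0)"
      using Suc.IH[OF less_imp_le[OF l]] by (rule subsetD[rotated])
    then obtain v where u_v: "u = mlp_layer \<alpha> W b l v" and v: "v \<in> carrier_vec (d 0)"
      by (rule imageE)
    have "W (Suc l) *\<^sub>v u + b (Suc l) = z"
      unfolding Wu[symmetric] using b_carrier[OF l] by (intro eq_vecI) (auto simp: z_def)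
    then have "y = mlp_layer \<alpha> W b (Suc l) v"
      using z u_v by simp
    then show "y \<in> mlp_layer \<alpha> W b (Suc l) ` carrier_vec (d 0)"
      using v by (rule image_eqI)
  qed
qed simp

(* The affine maps v \<mapsto> M v + c with which the first l layers can agree near a point:
   one for each choice of slopes s \<in> {1, alpha}^(d k) in every layer k \<le> l. *)
primrec affine_pieces :: "nat \<Rightarrow> (real mat \<times> real vec) set" where
  "affine_pieces 0 = {(1\<^sub>m (d 0), 0\<^sub>v (d 0))}"
| "affine_pieces (Suc l) =
     (\<lambda>(s, M, c). (mat_diag (d (Suc l)) s * (W (Suc l) * M),
                   mat_diag (d (Suc l)) s *\<^sub>v (W (Suc l) *\<^sub>v c + b (Suc l))))
       ` (({..<d (Suc l)} \<rightarrow>\<^sub>E {1, \<alpha>}) \<times> affine_pieces l)"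

lemma finite_affine_pieces: "finite (affine_pieces l)"
  by (induction l) (auto intro: finite_PiE)

lemma affine_piece_carrier:
  "l \<le> L \<Longrightarrow> (M, c) \<in> affine_pieces l \<Longrightarrow> M \<in> carrier_mat (d l) (d 0) \<and> c \<in> carrier_vec (d l)"
proof (induction l arbitrary: M c)
  case (Suc l)
  then have l: "l < L" by simp
  from Suc.prems obtain s M' c' where piece: "(M', c') \<in> affine_pieces l"
    and M: "M = mat_diag (d (Suc l)) s * (W (Suc l) * M')"
    and c: "c = mat_diag (d (Suc l)) s *\<^sub>v (W (Suc l) *\<^sub>v c' + b (Suc l))"
    by auto
  have "M' \<in> carrier_mat (d l) (d 0)" "c' \<in> carrier_vec (d l)"
    using Suc.IH[OF _ piece] l by auto
  moreover have "W (Suc l) \<in> carrier_mat (d (Suc l)) (d l)" "b (Suc l) \<in> carrier_vec (d (Suc l))"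
    using W_carrier[OF l] b_carrier[OF l] .
  ultimately have "W (Suc l) * M' \<in> carrier_mat (d (Suc l)) (d 0)"
    "W (Suc l) *\<^sub>v c' + b (Suc l) \<in> carrier_vec (d (Suc l))"
    by auto
  then show ?case
    unfolding M c by (auto intro: mult_carrier_mat[OF mat_diag_dim] mult_mat_vec_carrier[OF mat_diag_dim])
qed simp

lemma slope_pattern_nonzero: "s \<in> {..<n} \<rightarrow>\<^sub>E {1, \<alpha>} \<Longrightarrow> \<forall>i<n. s i \<noteq> 0"
  using alpha_pos unfolding PiE_def Pi_def by auto

lemma affine_piece_inj_on:
  assumes inc: "\<forall>k<L. d k \<le> d (Suc k)"
  shows "l \<le> L \<Longrightarrow> (M, c) \<in> affine_pieces l \<Longrightarrow> inj_on ((*\<^sub>v) M) (carrier_vec (d 0))"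
proof (induction l arbitrary: M c)
  case (Suc l)
  then have l: "l < L" by simp
  from Suc.prems obtain s M' c' where s: "s \<in> {..<d (Suc l)} \<rightarrow>\<^sub>E {1, \<alpha>}"
    and piece: "(M', c') \<in> affine_pieces l" and M: "M = mat_diag (d (Suc l)) s * (W (Suc l) * M')"
    by auto
  have M': "M' \<in> carrier_mat (d l) (d 0)"
    using affine_piece_carrier piece l by simp
  have "inj_on ((*\<^sub>v) (W (Suc l))) (carrier_vec (d l))"
    using W_inj_on[OF l] inc l by simp
  then have "inj_on ((*\<^sub>v) (W (Suc l) * M')) (carrier_vec (d 0))"
    using Suc.IH[OF _ piece] l by (intro inj_on_mult_mat_vec_mult[OF W_carrier[OF l] M']) auto
  then show ?case
    unfolding M using W_carrier[OF l] M'
    by (intro inj_on_mult_mat_vec_mult[OF mat_diag_dim] inj_on_mat_diag slope_pattern_nonzero[OF s]) auto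
qed (simp add: inj_on_def)

lemma affine_piece_onto:
  assumes dec: "\<forall>k<L. d (Suc k) \<le> d k"
  shows "l \<le> L \<Longrightarrow> (M, c) \<in> affine_pieces l \<Longrightarrow> carrier_vec (d l) \<subseteq> (*\<^sub>v) M ` carrier_vec (d 0)"
proof (induction l arbitrary: M c)
  case (Suc l)
  then have l: "l < L" by simp
  from Suc.prems obtain s M' c' where s: "s \<in> {..<d (Suc l)} \<rightarrow>\<^sub>E {1, \<alpha>}"
    and piece: "(M', c') \<in> affine_pieces l" and M: "M = mat_diag (d (Suc l)) s * (W (Suc l) * M')"
    by auto
  have M': "M' \<in> carrier_mat (d l) (d 0)"
    using affine_piece_carrier piece l by simp
  have "carrier_vec (d (Suc l)) \<subseteq> (*\<^sub>v) (W (Suc l)) ` carrier_vec (d l)"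
    using W_onto[OF l] dec l by simp
  then have "carrier_vec (d (Suc l)) \<subseteq> (*\<^sub>v) (W (Suc l) * M') ` carrier_vec (d 0)"
    using Suc.IH[OF _ piece] l by (intro image_mult_mat_vec_mult[OF W_carrier[OF l] M']) auto
  then show ?case
    unfolding M using W_carrier[OF l] M'
    by (intro image_mult_mat_vec_mult[OF mat_diag_dim] carrier_vec_subset_image_mat_diag
        slope_pattern_nonzero[OF s]) auto
qed (auto intro: rev_image_eqI)

lemma mlp_layer_Suc_locally_affine:
  assumes d0: "d 0 = CARD('n::finite)" and l: "l < L" and piece: "(M, c) \<in> affine_pieces l"
    and layer: "eventually (\<lambda>y. mlp_layer \<alpha> W b l (vec_of_cart y) = M *\<^sub>v vec_of_cart y + c)
      (nhds (x :: real^'n))"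
    and x: "x \<notin> kink_set (W (Suc l) * M) (W (Suc l) *\<^sub>v c + b (Suc l))"
  shows "\<exists>M' c'. (M', c') \<in> affine_pieces (Suc l) \<and>
    eventually (\<lambda>y. mlp_layer \<alpha> W b (Suc l) (vec_of_cart y) = M' *\<^sub>v vec_of_cart y + c') (nhds x)"
proof -
  let ?W = "W (Suc l)" and ?b = "b (Suc l)" and ?n = "d (Suc l)"
  have M: "M \<in> carrier_mat (d l) CARD('n)" and c: "c \<in> carrier_vec (d l)"
    using affine_piece_carrier[OF _ piece] l d0 by auto
  have A: "?W * M \<in> carrier_mat ?n CARD('n)" and e: "?W *\<^sub>v c + ?b \<in> carrier_vec ?n"
    using W_carrier[OF l] b_carrier[OF l] M c by auto
  obtain s where s: "s \<in> {..<?n} \<rightarrow>\<^sub>E {1, \<alpha>}" and relu: "eventually (\<lambda>y.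
      map_vec (leaky_relu \<alpha>) ((?W * M) *\<^sub>v vec_of_cart y + (?W *\<^sub>v c + ?b))
      = mat_diag ?n s *\<^sub>v ((?W * M) *\<^sub>v vec_of_cart y + (?W *\<^sub>v c + ?b))) (nhds x)"
    using eventually_map_leaky_relu_eq_mat_diag[OF A e x] by blast
  have "eventually (\<lambda>y. mlp_layer \<alpha> W b (Suc l) (vec_of_cart y)
      = (mat_diag ?n s * (?W * M)) *\<^sub>v vec_of_cart y + mat_diag ?n s *\<^sub>v (?W *\<^sub>v c + ?b)) (nhds x)"
    using layer relu
  proof eventually_elim
    case (elim y)
    let ?u = "vec_of_cart y"
    have u: "?u \<in> carrier_vec CARD('n)" by simp
    have "?W *\<^sub>v (M *\<^sub>v ?u + c) + ?b = ((?W * M) *\<^sub>v ?u + ?W *\<^sub>v c) + ?b"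
      by (simp only: mult_mat_vec_add_mult[OF W_carrier[OF l] M u c])
    also have "\<dots> = (?W * M) *\<^sub>v ?u + (?W *\<^sub>v c + ?b)"
      using A W_carrier[OF l] c b_carrier[OF l] by (intro assoc_add_vec) auto
    finally have affine_W: "?W *\<^sub>v (M *\<^sub>v ?u + c) + ?b = (?W * M) *\<^sub>v ?u + (?W *\<^sub>v c + ?b)" .
    have "mlp_layer \<alpha> W b (Suc l) ?u = map_vec (leaky_relu \<alpha>) (?W *\<^sub>v (M *\<^sub>v ?u + c) + ?b)"
      using elim(1) by simp
    also have "\<dots> = mat_diag ?n s *\<^sub>v ((?W * M) *\<^sub>v ?u + (?W *\<^sub>v c + ?b))"
      unfolding affine_W by (rule elim(2))
    also have "\<dots> = (mat_diag ?n s * (?W * M)) *\<^sub>v ?u + mat_diag ?n s *\<^sub>v (?W *\<^sub>v c + ?b)"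
      by (rule mult_mat_vec_add_mult[OF mat_diag_dim A u e])
    finally show ?case .
  qed
  moreover have "(mat_diag ?n s * (?W * M), mat_diag ?n s *\<^sub>v (?W *\<^sub>v c + ?b)) \<in> affine_pieces (Suc l)"
    using s piece unfolding affine_pieces.simps by (intro image_eqI[where x = "(s, M, c)"]) auto
  ultimately show ?thesis
    by blast
qed

lemma mlp_layer_locally_affine:
  assumes d0: "d 0 = CARD('n::finite)"
  shows "l \<le> L \<Longrightarrow> \<exists>N\<in>null_sets (lborel :: (real^'n) measure). \<forall>x. x \<notin> N \<longrightarrow>
    (\<exists>M c. (M, c) \<in> affine_pieces l \<and>
       eventually (\<lambda>y. mlp_layer \<alpha> W b l (vec_of_cart y) = M *\<^sub>v vec_of_cart y + c) (nhds x))"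
proof (induction l)
  case 0
  have "mlp_layer \<alpha> W b 0 (vec_of_cart y) = 1\<^sub>m (d 0) *\<^sub>v vec_of_cart y + 0\<^sub>v (d 0)" for y :: "real^'n"
    using d0 by simp
  then show ?case
    by auto
next
  case (Suc l)
  have l: "l < L"
    using Suc.prems by simp
  obtain N where N: "N \<in> null_sets (lborel :: (real^'n) measure)" and affine: "\<forall>x. x \<notin> N \<longrightarrow>
      (\<exists>M c. (M, c) \<in> affine_pieces l \<and>
         eventually (\<lambda>y. mlp_layer \<alpha> W b l (vec_of_cart y) = M *\<^sub>v vec_of_cart y + c) (nhds x))"
    using Suc.IH[OF less_imp_le[OF l]] by blast
  define N' where
    "N' = N \<union> (\<Union>(M, c)\<in>affine_pieces l. kink_set (W (Suc l) * M) (W (Suc l) *\<^sub>v c + b (Suc l)))"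
  have "(kink_set (W (Suc l) * M) (W (Suc l) *\<^sub>v c + b (Suc l)) :: (real^'n) set) \<in> null_sets lborel"
    if "(M, c) \<in> affine_pieces l" for M c
    using affine_piece_carrier[OF _ that] W_carrier[OF l] b_carrier[OF l] l d0
    by (intro kink_set_null) auto
  then have "N' \<in> null_sets lborel"
    unfolding N'_def using N finite_affine_pieces
    by (intro null_sets.Un null_sets_UN') (auto intro: countable_finite)
  moreover have "\<exists>M' c'. (M', c') \<in> affine_pieces (Suc l) \<and>
      eventually (\<lambda>y. mlp_layer \<alpha> W b (Suc l) (vec_of_cart y) = M' *\<^sub>v vec_of_cart y + c') (nhds x)"
    if x: "x \<notin> N'" for x
  proof -
    obtain M c where piece: "(M, c) \<in> affine_pieces l" and layer: "eventually
        (\<lambda>y. mlp_layer \<alpha> W b l (vec_of_cart y) = M *\<^sub>v vec_of_cart y + c) (nhds x)"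
      using affine x by (auto simp: N'_def)
    moreover have "x \<notin> kink_set (W (Suc l) * M) (W (Suc l) *\<^sub>v c + b (Suc l))"
      using x piece by (auto simp: N'_def)
    ultimately show ?thesis
      by (rule mlp_layer_Suc_locally_affine[OF d0 l])
  qed
  ultimately show ?case
    by blast
qed

lemma rank_matrix_cart_map_affine_piece:
  assumes d0: "d 0 = CARD('n::finite)" and dL: "d L = CARD('m::finite)"
    and mono: "(\<forall>l<L. d l \<le> d (Suc l)) \<or> (\<forall>l<L. d (Suc l) \<le> d l)"
    and piece: "(M, c) \<in> affine_pieces L"
  shows "rank (matrix (cart_map M :: real^'n \<Rightarrow> real^'m)) = min CARD('n) CARD('m)"
proof -
  have M: "M \<in> carrier_mat CARD('m) CARD('n)"
    using affine_piece_carrier[OF order_refl piece] d0 dL by simp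
  from mono show ?thesis
  proof
    assume inc: "\<forall>l<L. d l \<le> d (Suc l)"
    then have "CARD('n) \<le> CARD('m)"
      using lift_Suc_mono_le_bounded[OF inc, of 0 L] d0 dL by simp
    then show ?thesis
      using rank_matrix_cart_map(1)[OF M] affine_piece_inj_on[OF inc order_refl piece] d0
      by (simp add: min_absorb1)
  next
    assume dec: "\<forall>l<L. d (Suc l) \<le> d l"
    then have "CARD('m) \<le> CARD('n)"
      using lift_Suc_antimono_le_bounded[OF dec, of 0 L] d0 dL by simp
    then show ?thesis
      using rank_matrix_cart_map(2)[OF M] affine_piece_onto[OF dec order_refl piece] d0 dL
      by (simp add: min_absorb2)
  qed
qed

lemma has_derivative_mlp:
  assumes d0: "d 0 = CARD('n::finite)" and dL: "d L = CARD('m::finite)"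
    and piece: "(M, c) \<in> affine_pieces L"
    and layer: "eventually (\<lambda>y. mlp_layer \<alpha> W b L (vec_of_cart y) = M *\<^sub>v vec_of_cart y + c) (nhds x)"
  shows "((mlp \<alpha> W b L :: real^'n \<Rightarrow> real^'m) has_derivative cart_map M) (at x)"
proof -
  have M: "M \<in> carrier_mat CARD('m) CARD('n)" and c: "c \<in> carrier_vec CARD('m)"
    using affine_piece_carrier[OF order_refl piece] d0 dL by auto
  from layer have "eventually (\<lambda>y. (mlp \<alpha> W b L :: real^'n \<Rightarrow> real^'m) y
      = cart_of_vec (M *\<^sub>v vec_of_cart y + c)) (nhds x)"
    by eventually_elim (simp add: mlp_def)
  then show ?thesis
    by (rule has_derivative_cart_map_if_locally_affine[OF M c])
qed

lemma surj_mlp: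
  assumes d0: "d 0 = CARD('n::finite)" and dL: "d L = CARD('m::finite)"
    and mono: "(\<forall>l<L. d l \<le> d (Suc l)) \<or> (\<forall>l<L. d (Suc l) \<le> d l)"
    and le: "CARD('m) \<le> CARD('n)"
  shows "surj (mlp \<alpha> W b L :: real^'n \<Rightarrow> real^'m)"
proof -
  have dec: "\<forall>k<L. d (Suc k) \<le> d k"
    using mono
  proof
    assume inc: "\<forall>k<L. d k \<le> d (Suc k)"
    have "d (Suc k) \<le> d k" if "k < L" for k
      using lift_Suc_mono_le_bounded[OF inc, of "Suc k" L] lift_Suc_mono_le_bounded[OF inc, of 0 k]
        that le d0 dL by simp
    then show ?thesis by blast
  qed
  have "z \<in> range (mlp \<alpha> W b L :: real^'n \<Rightarrow> real^'m)" for z :: "real^'m"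
  proof -
    have "vec_of_cart z \<in> mlp_layer \<alpha> W b L ` carrier_vec (d 0)"
      using carrier_vec_subset_image_mlp_layer[OF dec order_refl] vec_of_cart_carrier[of z] unfolding dL by (rule subsetD)
    then obtain v where z: "vec_of_cart z = mlp_layer \<alpha> W b L v" and v: "v \<in> carrier_vec CARD('n)"
      unfolding d0 by (rule imageE)
    have "mlp \<alpha> W b L (cart_of_vec v :: real^'n) = z"
      by (simp add: mlp_def vec_of_cart_of_vec[OF v] z[symmetric])
    then show ?thesis
      by (metis rangeI)
  qed
  then show ?thesis
    by auto
qed

end

theorem proposition1:
  fixes \<alpha> :: real and W :: "nat \<Rightarrow> real mat" and b :: "nat \<Rightarrow> real Matrix.vec"
    and d :: "nat \<Rightarrow> nat" and L :: nat
  assumes alpha: "0 < \<alpha>" "\<alpha> < 1"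
    and d0: "d 0 = CARD('n::finite)" and dL: "d L = CARD('m::finite)"
    and W_dim: "\<forall>l\<in>{1..L}. W l \<in> carrier_mat (d l) (d (l - 1))"
    and b_dim: "\<forall>l\<in>{1..L}. b l \<in> carrier_vec (d l)"
    and W_rank: "\<forall>l\<in>{1..L}. vec_space.rank (d l) (W l) = min (d l) (d (l - 1))"
    and mono: "(\<forall>l<L. d l \<le> d (Suc l)) \<or> (\<forall>l<L. d (Suc l) \<le> d l)"
  shows "(\<exists>N. N \<in> null_sets (lborel :: (real^'n) measure) \<and>
            (\<forall>x. x \<notin> N \<longrightarrow>
               (\<exists>f'. ((mlp \<alpha> W b L :: real^'n \<Rightarrow> real^'m) has_derivative f') (at x)
                     \<and> rank (matrix f') = min CARD('n) CARD('m))))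
         \<and> (CARD('m) \<le> CARD('n) \<longrightarrow> surj (mlp \<alpha> W b L :: real^'n \<Rightarrow> real^'m))"
proof -
  interpret leaky_mlp \<alpha> W b d L
    using alpha W_dim b_dim W_rank by unfold_locales auto
  obtain N where N: "N \<in> null_sets (lborel :: (real^'n) measure)" and affine: "\<forall>x. x \<notin> N \<longrightarrow>
      (\<exists>M c. (M, c) \<in> affine_pieces L \<and>
         eventually (\<lambda>y. mlp_layer \<alpha> W b L (vec_of_cart y) = M *\<^sub>v vec_of_cart y + c) (nhds x))"
    using mlp_layer_locally_affine[OF d0 order_refl] by blast
  have "\<exists>f'. ((mlp \<alpha> W b L :: real^'n \<Rightarrow> real^'m) has_derivative f') (at x)
      \<and> rank (matrix f') = min CARD('n) CARD('m)" if x: "x \<notin> N" for x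
  proof -
    obtain M c where piece: "(M, c) \<in> affine_pieces L" and layer: "eventually
        (\<lambda>y. mlp_layer \<alpha> W b L (vec_of_cart y) = M *\<^sub>v vec_of_cart y + c) (nhds x)"
      using affine x by blast
    show ?thesis
      using has_derivative_mlp[OF d0 dL piece layer] rank_matrix_cart_map_affine_piece[OF d0 dL mono piece]
      by blast
  qed
  then show ?thesis
    using N surj_mlp[OF d0 dL mono] by blast
qed

end
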